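(* If a ring $R$ is right quasi-continuous and right nonsingular, then $R$ is almost clean.
   Context: Rings are associative with identity. An element of a ring is regular if it is neither a left nor a right zero-divisor, i.e. both its left and right annihilators are zero. A ring is almost clean if each of its elements is the sum of a regular element and an idempotent. A ring $R$ is right quasi-continuous if the right module $M=R_R$ satisfies (C1) every submodule of $M$ is essential in a direct summand of $M$, and (C3) if $A$ and $B$ are direct summands of $M$ with $A\cap B=0$, then $A\oplus B$ is also a direct summand of $M$. A ring $R$ is right nonsingular if no nonzero element of $R$ has an essential right ideal as its right annihilator. *)

theory Defs
  imports Main "HOL-Library.Set_Algebras"
begin

text \<open>
  A ring is a type of sort \<open>{ring, monoid_mult}\<close>: associative, with identity, not assumed
  commutative. The class \<open>ring_1\<close> is avoided because it would exclude the zero ring.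
  Properties of the whole ring are stated as predicates on \<open>TYPE('a)\<close>.
\<close>

definition left_annihilator :: "'a::{ring, monoid_mult} \<Rightarrow> 'a set" where
  "left_annihilator a = {r. r * a = 0}"

definition right_annihilator :: "'a::{ring, monoid_mult} \<Rightarrow> 'a set" where
  "right_annihilator a = {r. a * r = 0}"

definition regular_element :: "'a::{ring, monoid_mult} \<Rightarrow> bool" where
  "regular_element a \<longleftrightarrow> left_annihilator a = {0} \<and> right_annihilator a = {0}"

definition idempotent_element :: "'a::{ring, monoid_mult} \<Rightarrow> bool" where
  "idempotent_element e \<longleftrightarrow> e * e = e"

definition almost_clean :: "'a::{ring, monoid_mult} itself \<Rightarrow> bool" where
  "almost_clean (_ :: 'a itself) \<longleftrightarrow>
     (\<forall>a::'a. \<exists>u e. regular_element u \<and> idempotent_element e \<and> a = u + e)"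

text \<open>
  The submodules of the right module $R_R$ are the right ideals of $R$; the notions below are the
  usual module-theoretic ones for submodules of $R_R$, with \<open>UNIV\<close> being $R_R$ itself.
\<close>

definition right_ideal :: "'a::{ring, monoid_mult} set \<Rightarrow> bool" where
  "right_ideal I \<longleftrightarrow>
     0 \<in> I \<and> (\<forall>x\<in>I. \<forall>y\<in>I. x - y \<in> I) \<and> (\<forall>x\<in>I. \<forall>r. x * r \<in> I)"

definition essential_in :: "'a::{ring, monoid_mult} set \<Rightarrow> 'a set \<Rightarrow> bool" where
  "essential_in N D \<longleftrightarrow>
     right_ideal N \<and> right_ideal D \<and> N \<subseteq> D \<and>
     (\<forall>K. right_ideal K \<and> K \<subseteq> D \<and> K \<noteq> {0} \<longrightarrow> N \<inter> K \<noteq> {0})"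

text \<open>Here \<open>A + B\<close> is the elementwise sum of sets.\<close>

definition direct_summand :: "'a::{ring, monoid_mult} set \<Rightarrow> bool" where
  "direct_summand A \<longleftrightarrow>
     right_ideal A \<and> (\<exists>B. right_ideal B \<and> A \<inter> B = {0} \<and> A + B = UNIV)"

definition C1 :: "'a::{ring, monoid_mult} itself \<Rightarrow> bool" where
  "C1 (_ :: 'a itself) \<longleftrightarrow>
     (\<forall>N::'a set. right_ideal N \<longrightarrow> (\<exists>D. direct_summand D \<and> essential_in N D))"

definition C3 :: "'a::{ring, monoid_mult} itself \<Rightarrow> bool" where
  "C3 (_ :: 'a itself) \<longleftrightarrow>
     (\<forall>A B :: 'a set. direct_summand A \<and> direct_summand B \<and> A \<inter> B = {0} \<longrightarrow>
        direct_summand (A + B))"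

definition right_quasi_continuous :: "'a::{ring, monoid_mult} itself \<Rightarrow> bool" where
  "right_quasi_continuous (R :: 'a itself) \<longleftrightarrow> C1 R \<and> C3 R"

definition right_nonsingular :: "'a::{ring, monoid_mult} itself \<Rightarrow> bool" where
  "right_nonsingular (_ :: 'a itself) \<longleftrightarrow>
     \<not> (\<exists>x::'a. x \<noteq> 0 \<and> essential_in (right_annihilator x) UNIV)"

end

theory Submission
  imports Defs
begin

text \<open>
  To write \<open>a\<close> as a regular element plus an idempotent \<open>e\<close>, it suffices to find right ideals \<open>A\<close> and
  \<open>B\<close>, independent and with essential sum, on which \<open>e\<close> is to act as \<open>1\<close> and as \<open>0\<close>. Such an \<open>e\<close>
  exists by (C1) and (C3) (\<open>quasi_continuous_idempotent\<close>). The element \<open>u = a - e\<close> then acts as \<open>a - 1\<close> on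
  \<open>A\<close> and as \<open>a\<close> on \<open>B\<close>. If it is injective on \<open>A + B\<close> with essential image, it has no right
  annihilator, because \<open>A + B\<close> is essential, and no left annihilator, because in a nonsingular ring
  nothing nonzero annihilates an essential right ideal (\<open>regular_elementI\<close>). So only the pair \<open>(A, B)\<close> has
  to be found, and this is a question about right ideals up to essential extension.

  The pair comes from Zorn's lemma. Injectivity of \<open>u\<close> alone would not give the right maximal
  elements: for a shift \<open>a\<close>, the pair with \<open>A = 0\<close> and \<open>B\<close> everything is maximal, but the image is
  too small. Therefore the image of \<open>A + B\<close> is required at every stage to have the same closure \<open>N\<close>
  as \<open>A + B\<close> itself, where the closure of a right ideal is its largest essential extension. Then \<open>N\<close> is
  stable under \<open>a\<close>, and as long as \<open>N\<close> is not the whole ring the pair can be enlarged by working modulo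
  \<open>N\<close> (\<open>partial_decomposition_extend\<close>). If \<open>a\<close> or \<open>a - 1\<close> has a kernel modulo \<open>N\<close>, or if \<open>a\<close> has
  essential image modulo \<open>N\<close>, it is clear how to enlarge. Otherwise some nonzero right ideal \<open>K\<close> avoids
  the image of \<open>a\<close>, its translates \<open>a\<^sup>i K\<close> are independent, \<open>a\<close> acts on their sum as a shift,
  and the shift is decomposed by explicit polynomials in \<open>a\<close> (\<open>partial_decomposition_enlarge\<close>).
\<close>

section \<open>Right ideals\<close>

lemma right_idealD:
  assumes "right_ideal I"
  shows "0 \<in> I" "x \<in> I \<Longrightarrow> y \<in> I \<Longrightarrow> x - y \<in> I" "x \<in> I \<Longrightarrow> x * r \<in> I"
    "x \<in> I \<Longrightarrow> - x \<in> I" "x \<in> I \<Longrightarrow> y \<in> I \<Longrightarrow> x + y \<in> I"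
proof -
  show zero: "0 \<in> I" and diff: "x \<in> I \<Longrightarrow> y \<in> I \<Longrightarrow> x - y \<in> I" for x y
    using assms by (auto simp: right_ideal_def)
  show "x \<in> I \<Longrightarrow> x * r \<in> I"
    using assms by (auto simp: right_ideal_def)
  have minus: "- y \<in> I" if "y \<in> I" for y
    using diff[OF zero that] by simp
  show "x \<in> I \<Longrightarrow> - x \<in> I"
    by (rule minus)
  show "x \<in> I \<Longrightarrow> y \<in> I \<Longrightarrow> x + y \<in> I"
    using diff[OF _ minus, of x y] by simp
qed

lemma right_ideal_UNIV: "right_ideal UNIV"
  by (simp add: right_ideal_def)

lemma right_ideal_zero: "right_ideal {0}"
  by (simp add: right_ideal_def)

lemma right_ideal_left_mult:
  assumes "right_ideal I"
  shows "right_ideal ((*) b ` I)"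
  unfolding right_ideal_def
proof (intro conjI ballI allI)
  show "0 \<in> (*) b ` I"
    using right_idealD(1)[OF assms] by (auto intro!: image_eqI[of _ _ 0])
next
  fix x y assume "x \<in> (*) b ` I" "y \<in> (*) b ` I"
  then obtain x' y' where "x' \<in> I" "y' \<in> I" "x = b * x'" "y = b * y'"
    by auto
  then show "x - y \<in> (*) b ` I"
    using right_idealD(2)[OF assms, of x' y'] by (auto simp: right_diff_distrib[symmetric])
next
  fix x r assume "x \<in> (*) b ` I"
  then obtain x' where "x' \<in> I" "x = b * x'"
    by auto
  then show "x * r \<in> (*) b ` I"
    using right_idealD(3)[OF assms, of x' r] by (auto simp: mult.assoc)
qed

lemma right_ideal_plus:
  assumes "right_ideal I" "right_ideal J"
  shows "right_ideal (I + J)"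
  unfolding right_ideal_def
proof (intro conjI ballI allI)
  show "0 \<in> I + J"
    using right_idealD(1)[OF assms(1)] right_idealD(1)[OF assms(2)]
    by (metis add.right_neutral set_plus_intro)
next
  fix x y assume "x \<in> I + J" "y \<in> I + J"
  then obtain i j i' j' where
    "i \<in> I" "j \<in> J" "i' \<in> I" "j' \<in> J" "x = i + j" "y = i' + j'"
    by (auto elim!: set_plus_elim)
  moreover from this have "x - y = (i - i') + (j - j')"
    by simp
  ultimately show "x - y \<in> I + J"
    by (simp only:) (intro set_plus_intro right_idealD(2) assms)
next
  fix x r assume "x \<in> I + J"
  then obtain i j where "i \<in> I" "j \<in> J" "x = i + j"
    by (auto elim!: set_plus_elim)
  then show "x * r \<in> I + J"
    by (simp add: distrib_right) (intro set_plus_intro right_idealD(3) assms)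
qed

lemma subset_plus_right_ideal:
  assumes "right_ideal I" "right_ideal J"
  shows "I \<subseteq> I + J" "J \<subseteq> I + J"
  using right_idealD(1)[OF assms(1)] right_idealD(1)[OF assms(2)]
  by (metis add.right_neutral set_plus_intro subsetI, metis add.left_neutral set_plus_intro subsetI)

lemma plus_subset_right_ideal:
  assumes "right_ideal M" "I \<subseteq> M" "J \<subseteq> M"
  shows "I + J \<subseteq> M"
  using assms right_idealD(5)[OF assms(1)] by (auto elim!: set_plus_elim)

lemma essential_in_element:
  assumes "essential_in N D" "x \<in> D" "x \<noteq> 0"
  obtains r where "x * r \<in> N" "x * r \<noteq> 0"
proof -
  have D: "right_ideal D" and N: "right_ideal N"
    using assms(1) by (auto simp: essential_in_def)
  have K: "right_ideal (range ((*) x))"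
    by (rule right_ideal_left_mult[OF right_ideal_UNIV])
  have "range ((*) x) \<subseteq> D"
    using right_idealD(3)[OF D assms(2)] by auto
  moreover have "range ((*) x) \<noteq> {0}"
    using assms(3) by (metis mult.right_neutral rangeI singletonD)
  ultimately have "N \<inter> range ((*) x) \<noteq> {0}"
    using assms(1) K by (auto simp: essential_in_def)
  then show thesis
    using that right_idealD(1)[OF N] right_idealD(1)[OF K] by blast
qed

lemma C1D:
  assumes "C1 TYPE('a::{ring, monoid_mult})" "right_ideal (N :: 'a set)"
  obtains D where "direct_summand D" "essential_in N D"
  using assms unfolding C1_def by blast

section \<open>The closure of a right ideal in the Goldie topology\<close>

text \<open>
  The elements \<open>x\<close> for which the right ideal of all \<open>s\<close> with \<open>x * s \<in> N\<close> is essential. Over a right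
  nonsingular ring this is the largest essential extension of \<open>N\<close> inside the ring, so that
  \<open>ess_closure N = UNIV\<close> says that \<open>N\<close> is essential. Essentiality is tested on elements.
\<close>
definition ess_closure :: "'a::{ring, monoid_mult} set \<Rightarrow> 'a set" where
  "ess_closure N = {x. \<forall>k. k \<noteq> 0 \<longrightarrow> (\<exists>r. k * r \<noteq> 0 \<and> x * (k * r) \<in> N)}"

lemma ess_closureE:
  assumes "x \<in> ess_closure N" "k \<noteq> 0"
  obtains r where "k * r \<noteq> 0" "x * (k * r) \<in> N"
  using assms by (auto simp: ess_closure_def)

lemma ess_closure_mono: "M \<subseteq> N \<Longrightarrow> ess_closure M \<subseteq> ess_closure N"
  unfolding ess_closure_def by blast

lemma subset_ess_closure:
  assumes "right_ideal N"
  shows "N \<subseteq> ess_closure N"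
  using right_idealD(3)[OF assms] by (auto simp: ess_closure_def intro!: exI[of _ 1])

lemma right_ideal_ess_closure:
  assumes N: "right_ideal N"
  shows "right_ideal (ess_closure N)"
  unfolding right_ideal_def
proof (intro conjI ballI allI)
  show "0 \<in> ess_closure N"
    using subset_ess_closure[OF N] right_idealD(1)[OF N] by auto
next
  fix x y assume xy: "x \<in> ess_closure N" "y \<in> ess_closure N"
  have "\<exists>r. k * r \<noteq> 0 \<and> (x - y) * (k * r) \<in> N" if k: "k \<noteq> 0" for k
  proof -
    obtain r where r: "k * r \<noteq> 0" "x * (k * r) \<in> N"
      using ess_closureE[OF xy(1) k] .
    obtain s where s: "(k * r) * s \<noteq> 0" "y * ((k * r) * s) \<in> N"
      using ess_closureE[OF xy(2) r(1)] .
    have "x * (k * r) * s - y * ((k * r) * s) \<in> N"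
      using right_idealD(2,3)[OF N] r(2) s(2) by blast
    then show ?thesis
      using s(1) by (intro exI[of _ "r * s"]) (simp add: algebra_simps)
  qed
  then show "x - y \<in> ess_closure N"
    by (simp add: ess_closure_def)
next
  fix x t assume x: "x \<in> ess_closure N"
  have "\<exists>r. k * r \<noteq> 0 \<and> (x * t) * (k * r) \<in> N" if "k \<noteq> 0" for k
  proof (cases "t * k = 0")
    case True
    then show ?thesis
      using that right_idealD(1)[OF N] by (intro exI[of _ 1]) (simp add: mult.assoc)
  next
    case False
    obtain r where r: "(t * k) * r \<noteq> 0" "x * ((t * k) * r) \<in> N"
      using ess_closureE[OF x False] .
    then have "k * r \<noteq> 0"
      by (auto simp: mult.assoc)
    with r(2) show ?thesis
      by (intro exI[of _ r]) (simp add: mult.assoc)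
  qed
  then show "x * t \<in> ess_closure N"
    by (simp add: ess_closure_def)
qed

lemma left_mult_ess_closure:
  assumes "\<And>n. n \<in> N \<Longrightarrow> b * n \<in> M" "x \<in> ess_closure N"
  shows "b * x \<in> ess_closure M"
  using assms unfolding ess_closure_def by (fastforce simp: mult.assoc)

lemma essential_in_imp_subset_ess_closure:
  assumes "essential_in N D"
  shows "D \<subseteq> ess_closure N"
proof
  fix x assume x: "x \<in> D"
  have D: "right_ideal D" and N: "right_ideal N"
    using assms by (auto simp: essential_in_def)
  have "\<exists>r. k * r \<noteq> 0 \<and> x * (k * r) \<in> N" if "k \<noteq> 0" for k
  proof (cases "x * k = 0")
    case True
    then show ?thesis
      using that right_idealD(1)[OF N] by (intro exI[of _ 1]) simp
  next
    case False
    obtain r where "x * k * r \<in> N" "x * k * r \<noteq> 0"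
      using essential_in_element[OF assms right_idealD(3)[OF D x] False] .
    then show ?thesis
      by (intro exI[of _ r]) (auto simp: mult.assoc)
  qed
  then show "x \<in> ess_closure N"
    by (simp add: ess_closure_def)
qed

text \<open>Nonsingularity says exactly that \<open>{0}\<close> is closed: closure points of \<open>{0}\<close> are the elements
  whose right annihilator is essential.\<close>
lemma nonsingular_ess_closure_zero:
  assumes "right_nonsingular TYPE('a::{ring, monoid_mult})"
    and x: "(x::'a) \<in> ess_closure {0}"
  shows "x = 0"
proof (rule ccontr)
  assume "x \<noteq> 0"
  have ann: "right_ideal (right_annihilator x)"
    by (auto simp: right_ideal_def right_annihilator_def right_diff_distrib mult.assoc[symmetric])
  have "right_annihilator x \<inter> K \<noteq> {0}" if K: "right_ideal K" "K \<noteq> {0}" for K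
  proof -
    obtain k where k: "k \<in> K" "k \<noteq> 0"
      using K right_idealD(1)[OF K(1)] by auto
    obtain r where r: "k * r \<noteq> 0" "x * (k * r) \<in> {0}"
      using ess_closureE[OF x k(2)] .
    then show ?thesis
      using right_idealD(3)[OF K(1) k(1), of r] by (auto simp: right_annihilator_def)
  qed
  then have "essential_in (right_annihilator x) UNIV"
    using ann by (auto simp: essential_in_def right_ideal_UNIV)
  with assms(1) \<open>x \<noteq> 0\<close> show False
    by (auto simp: right_nonsingular_def)
qed

lemma ess_closure_meets:
  assumes "right_nonsingular TYPE('a::{ring, monoid_mult})"
    and "(x::'a) \<in> ess_closure N" "x \<noteq> 0"
  obtains r where "x * r \<in> N" "x * r \<noteq> 0"
proof -
  have "x \<notin> ess_closure {0}"
    using nonsingular_ess_closure_zero[OF assms(1)] assms(3) by auto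
  then obtain k where k: "k \<noteq> 0" "\<And>r. k * r \<noteq> 0 \<Longrightarrow> x * (k * r) \<noteq> 0"
    by (auto simp: ess_closure_def)
  obtain r where "k * r \<noteq> 0" "x * (k * r) \<in> N"
    using ess_closureE[OF assms(2) k(1)] .
  with k(2) that show thesis
    by blast
qed

lemma ess_closure_idem:
  assumes "right_nonsingular TYPE('a::{ring, monoid_mult})"
    and N: "right_ideal (N :: 'a set)"
  shows "ess_closure (ess_closure N) = ess_closure N"
proof
  show "ess_closure (ess_closure N) \<subseteq> ess_closure N"
  proof
    fix x assume x: "x \<in> ess_closure (ess_closure N)"
    have "\<exists>r. k * r \<noteq> 0 \<and> x * (k * r) \<in> N" if k: "k \<noteq> 0" for k
    proof -
      obtain r where r: "k * r \<noteq> 0" "x * (k * r) \<in> ess_closure N"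
        using ess_closureE[OF x k] .
      have "k * r \<notin> ess_closure {0}"
        using nonsingular_ess_closure_zero[OF assms(1)] r(1) by auto
      then obtain l where l: "l \<noteq> 0" "\<And>s. l * s \<noteq> 0 \<Longrightarrow> (k * r) * (l * s) \<noteq> 0"
        by (auto simp: ess_closure_def)
      obtain s where s: "l * s \<noteq> 0" "x * (k * r) * (l * s) \<in> N"
        using ess_closureE[OF r(2) l(1)] .
      show ?thesis
        using l(2)[OF s(1)] s(2) by (intro exI[of _ "r * (l * s)"]) (simp add: mult.assoc)
    qed
    then show "x \<in> ess_closure N"
      by (simp add: ess_closure_def)
  qed
  show "ess_closure N \<subseteq> ess_closure (ess_closure N)"
    by (rule subset_ess_closure[OF right_ideal_ess_closure[OF N]])
qed

lemma ess_closure_least: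
  assumes "right_nonsingular TYPE('a::{ring, monoid_mult})"
    and "right_ideal (N :: 'a set)" "M \<subseteq> ess_closure N"
  shows "ess_closure M \<subseteq> ess_closure N"
  using ess_closure_mono[OF assms(3)] ess_closure_idem[OF assms(1,2)] by simp

text \<open>A failure of the closure condition at \<open>x\<close> is witnessed by some \<open>k\<close>, and then \<open>x * k\<close>
  generates a right ideal that meets the closed ideal trivially.\<close>
lemma independent_right_ideal_outside_closed:
  assumes closed: "ess_closure N = N" and "right_ideal N" "right_ideal X" "\<not> X \<subseteq> N"
  obtains C where "right_ideal C" "C \<subseteq> X" "C \<noteq> {0}" "C \<inter> N = {0}"
proof -
  obtain x where x: "x \<in> X" "x \<notin> ess_closure N"
    using assms by auto
  then obtain k where k: "k \<noteq> 0" "\<And>r. k * r \<noteq> 0 \<Longrightarrow> x * (k * r) \<notin> N"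
    by (auto simp: ess_closure_def)
  let ?C = "range ((*) (x * k))"
  have C: "right_ideal ?C"
    by (rule right_ideal_left_mult[OF right_ideal_UNIV])
  show thesis
  proof
    show "right_ideal ?C"
      by (rule C)
    show "?C \<subseteq> X"
      using x(1) right_idealD(3)[OF assms(3)] by (auto simp: mult.assoc)
    have "x * k \<noteq> 0"
      using k(1) k(2)[of 1] right_idealD(1)[OF assms(2)] by auto
    then show "?C \<noteq> {0}"
      by (metis mult.right_neutral rangeI singletonD)
    have "x * k * r = 0" if "x * k * r \<in> N" for r
      using that k(2)[of r] by (cases "k * r = 0") (auto simp: mult.assoc)
    then show "?C \<inter> N = {0}"
      using right_idealD(1)[OF assms(2)] right_idealD(1)[OF C] by auto
  qed
qed

section \<open>Partial clean decompositions of an element\<close>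

text \<open>
  The closed ideal of \<open>A + B\<close> is then stable under left multiplication by \<open>a\<close>, and an idempotent
  acting as \<open>1\<close> on \<open>A\<close> and as \<open>0\<close> on \<open>B\<close> would make \<open>a\<close> minus it regular on this ideal: injective,
  with image essential in the ideal.
\<close>
definition partial_decomposition :: "'a::{ring, monoid_mult} \<Rightarrow> 'a set \<Rightarrow> 'a set \<Rightarrow> bool" where
  "partial_decomposition a A B \<longleftrightarrow>
     right_ideal A \<and> right_ideal B \<and>
     (\<forall>x\<in>A. \<forall>y\<in>B. x + y = 0 \<longrightarrow> x = 0 \<and> y = 0) \<and>
     (\<forall>x\<in>A. \<forall>y\<in>B. (a - 1) * x + a * y = 0 \<longrightarrow> x = 0 \<and> y = 0) \<and>
     (\<forall>x\<in>A. \<forall>y\<in>B. (a - 1) * x + a * y \<in> ess_closure (A + B)) \<and>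
     (\<forall>x\<in>A. \<forall>y\<in>B. x + y \<in> ess_closure ((*) (a - 1) ` A + (*) a ` B))"

lemma partial_decompositionD:
  assumes "partial_decomposition a A B"
  shows "right_ideal A" "right_ideal B"
    "x \<in> A \<Longrightarrow> y \<in> B \<Longrightarrow> x + y = 0 \<Longrightarrow> x = 0 \<and> y = 0"
    "x \<in> A \<Longrightarrow> y \<in> B \<Longrightarrow> (a - 1) * x + a * y = 0 \<Longrightarrow> x = 0 \<and> y = 0"
    "x \<in> A \<Longrightarrow> y \<in> B \<Longrightarrow> (a - 1) * x + a * y \<in> ess_closure (A + B)"
    "x \<in> A \<Longrightarrow> y \<in> B \<Longrightarrow> x + y \<in> ess_closure ((*) (a - 1) ` A + (*) a ` B)"
  using assms unfolding partial_decomposition_def by blast+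

lemma partial_decomposition_zero: "partial_decomposition a {0} {0}"
  using subset_ess_closure[OF right_ideal_zero]
  by (simp add: partial_decomposition_def set_plus_def right_ideal_zero)

lemma partial_decomposition_invariant:
  assumes ns: "right_nonsingular TYPE('a::{ring, monoid_mult})"
    and dec: "partial_decomposition (a::'a) A B"
    and x: "x \<in> ess_closure (A + B)"
  shows "a * x \<in> ess_closure (A + B)"
proof -
  note A = partial_decompositionD(1)[OF dec] and B = partial_decompositionD(2)[OF dec]
  have W: "right_ideal (A + B)"
    by (rule right_ideal_plus[OF A B])
  have "a * w \<in> ess_closure (A + B)" if "w \<in> A + B" for w
  proof -
    obtain x y where xy: "x \<in> A" "y \<in> B" "w = x + y"
      using \<open>w \<in> A + B\<close> by (rule set_plus_elim)
    have "(a - 1) * x + a * y + x \<in> ess_closure (A + B)"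
      using partial_decompositionD(5)[OF dec xy(1,2)] subset_plus_right_ideal(1)[OF A B]
        subset_ess_closure[OF W] xy(1) right_idealD(5)[OF right_ideal_ess_closure[OF W]] by blast
    then show ?thesis
      using xy(3) by (simp add: algebra_simps)
  qed
  from left_mult_ess_closure[OF this x] show ?thesis
    using ess_closure_idem[OF ns W] by simp
qed

text \<open>
  Decompositions can be enlarged by a decomposition relative to the closure \<open>N\<close> of \<open>A + B\<close>: since
  \<open>N\<close> is stable under \<open>a\<close>, this is a partial decomposition of the map that \<open>a\<close> induces on the
  quotient module of the ring by \<open>N\<close>. Injectivity lifts because \<open>A + B\<close> and its image both lie in
  \<open>N\<close>, and density lifts because both are essential in \<open>N\<close>.
\<close>
lemma partial_decomposition_extend:
  fixes a :: "'a::{ring, monoid_mult}"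
  assumes ns: "right_nonsingular TYPE('a)"
    and dec: "partial_decomposition a A B"
    and C: "right_ideal C" and D: "right_ideal D"
    and N: "N = ess_closure (A + B)"
    and indep: "\<And>x y. x \<in> C \<Longrightarrow> y \<in> D \<Longrightarrow> x + y \<in> N \<Longrightarrow> x = 0 \<and> y = 0"
    and inj: "\<And>x y. x \<in> C \<Longrightarrow> y \<in> D \<Longrightarrow> (a - 1) * x + a * y \<in> N \<Longrightarrow> x = 0 \<and> y = 0"
    and into: "\<And>x y. x \<in> C \<Longrightarrow> y \<in> D \<Longrightarrow> (a - 1) * x + a * y \<in> ess_closure (C + D + N)"
    and onto: "\<And>x y. x \<in> C \<Longrightarrow> y \<in> D \<Longrightarrow>
      x + y \<in> ess_closure ((*) (a - 1) ` C + (*) a ` D + N)"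
  shows "partial_decomposition a (A + C) (B + D)"
proof -
  note A = partial_decompositionD(1)[OF dec] and B = partial_decompositionD(2)[OF dec]
  have W: "right_ideal (A + B)"
    by (rule right_ideal_plus[OF A B])
  have NI: "right_ideal N"
    unfolding N by (rule right_ideal_ess_closure[OF W])
  have WN: "A + B \<subseteq> N"
    unfolding N by (rule subset_ess_closure[OF W])
  let ?W = "A + C + (B + D)"
  let ?V = "(*) (a - 1) ` (A + C) + (*) a ` (B + D)"
  have W': "right_ideal ?W"
    by (intro right_ideal_plus A B C D)
  have V': "right_ideal ?V"
    by (intro right_ideal_plus right_ideal_left_mult A B C D)
  note cW = right_ideal_ess_closure[OF W'] and cV = right_ideal_ess_closure[OF V']
  note sAC = subset_plus_right_ideal[OF A C] and sBD = subset_plus_right_ideal[OF B D]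
  have NW: "N \<subseteq> ess_closure ?W"
    unfolding N by (intro ess_closure_mono set_plus_mono2 sAC sBD)
  have "C + D \<subseteq> ?W"
    by (intro set_plus_mono2 sAC sBD)
  then have "C + D + N \<subseteq> ess_closure ?W"
    using NW subset_ess_closure[OF W'] by - (rule plus_subset_right_ideal[OF cW]; auto)
  then have intoW: "ess_closure (C + D + N) \<subseteq> ess_closure ?W"
    by (rule ess_closure_least[OF ns W'])
  have "(*) (a - 1) ` A + (*) a ` B \<subseteq> ?V" and CDV: "(*) (a - 1) ` C + (*) a ` D \<subseteq> ?V"
    by (intro set_plus_mono2 image_mono sAC sBD)+
  then have WV: "A + B \<subseteq> ess_closure ?V"
    using partial_decompositionD(6)[OF dec] ess_closure_mono by (blast elim!: set_plus_elim)
  then have "N \<subseteq> ess_closure ?V"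
    unfolding N by (rule ess_closure_least[OF ns V'])
  then have "(*) (a - 1) ` C + (*) a ` D + N \<subseteq> ess_closure ?V"
    using CDV subset_ess_closure[OF V'] by - (rule plus_subset_right_ideal[OF cV]; auto)
  then have ontoV: "ess_closure ((*) (a - 1) ` C + (*) a ` D + N) \<subseteq> ess_closure ?V"
    by (rule ess_closure_least[OF ns V'])
  have main: "(x + y = 0 \<longrightarrow> x = 0 \<and> y = 0) \<and>
      ((a - 1) * x + a * y = 0 \<longrightarrow> x = 0 \<and> y = 0) \<and>
      (a - 1) * x + a * y \<in> ess_closure ?W \<and> x + y \<in> ess_closure ?V"
    if "x \<in> A + C" "y \<in> B + D" for x y
  proof -
    obtain x1 x2 where x: "x1 \<in> A" "x2 \<in> C" "x = x1 + x2"
      using \<open>x \<in> A + C\<close> by (rule set_plus_elim)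
    obtain y1 y2 where y: "y1 \<in> B" "y2 \<in> D" "y = y1 + y2"
      using \<open>y \<in> B + D\<close> by (rule set_plus_elim)
    have split: "x + y = (x1 + y1) + (x2 + y2)"
      "(a - 1) * x + a * y = ((a - 1) * x1 + a * y1) + ((a - 1) * x2 + a * y2)"
      by (simp_all add: x y algebra_simps)
    have in_N: "x1 + y1 \<in> N" "(a - 1) * x1 + a * y1 \<in> N"
      using WN x y partial_decompositionD(5)[OF dec] by (auto simp: N)
    have "x = 0 \<and> y = 0" if "x + y = 0"
    proof -
      have "x2 + y2 = - (x1 + y1)"
        using that split(1) by (intro minus_unique[symmetric]) (simp only:)
      then have "x2 = 0 \<and> y2 = 0"
        using indep[OF x(2) y(2)] right_idealD(4)[OF NI in_N(1)] by simp
      then show ?thesis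
        using partial_decompositionD(3)[OF dec x(1) y(1)] that x y by simp
    qed
    moreover have "x = 0 \<and> y = 0" if "(a - 1) * x + a * y = 0"
    proof -
      have "(a - 1) * x2 + a * y2 = - ((a - 1) * x1 + a * y1)"
        using that split(2) by (intro minus_unique[symmetric]) (simp only:)
      then have "x2 = 0 \<and> y2 = 0"
        using inj[OF x(2) y(2)] right_idealD(4)[OF NI in_N(2)] by simp
      then show ?thesis
        using partial_decompositionD(4)[OF dec x(1) y(1)] that x y by simp
    qed
    moreover have "(a - 1) * x + a * y \<in> ess_closure ?W"
      unfolding split(2) using in_N(2) NW into[OF x(2) y(2)] intoW
      by - (rule right_idealD(5)[OF cW]; blast)
    moreover have "x + y \<in> ess_closure ?V"
      unfolding split(1) using WV x(1) y(1) onto[OF x(2) y(2)] ontoV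
      by - (rule right_idealD(5)[OF cV]; blast intro: set_plus_intro)
    ultimately show ?thesis
      by blast
  qed
  show ?thesis
    unfolding partial_decomposition_def using main right_ideal_plus[OF A C] right_ideal_plus[OF B D]
    by blast
qed

section \<open>The shift\<close>

text \<open>
  The right ideal \<open>K + b\<^sup>2 K + b\<^sup>4 K + \<dots>\<close>, in Horner form: the elements \<open>f(b)\<close> for even polynomials
  \<open>f\<close> with coefficients in \<open>K\<close>.
\<close>
inductive_set even_span :: "'a::{ring, monoid_mult} \<Rightarrow> 'a set \<Rightarrow> 'a set"
  for b :: 'a and K :: "'a set"
where
  zero: "0 \<in> even_span b K"
| step: "k \<in> K \<Longrightarrow> p \<in> even_span b K \<Longrightarrow> k + b * (b * p) \<in> even_span b K"

lemma even_span_double_step: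
  assumes "right_ideal K" "p \<in> even_span b K"
  shows "b * (b * p) \<in> even_span b K"
  using even_span.step[OF right_idealD(1)[OF assms(1)] assms(2)] by simp

lemma subset_even_span: "K \<subseteq> even_span b K"
  using even_span.step[OF _ even_span.zero, of _ K b] by auto

lemma right_ideal_even_span:
  assumes K: "right_ideal K"
  shows "right_ideal (even_span b K)"
  unfolding right_ideal_def
proof (intro conjI ballI allI)
  show "0 \<in> even_span b K"
    by (rule even_span.zero)
next
  have minus: "- q \<in> even_span b K" if "q \<in> even_span b K" for q
    using that
  proof induction
    case (step k p)
    have "- (k + b * (b * p)) = - k + b * (b * - p)"
      by simp
    with even_span.step[OF right_idealD(4)[OF K step(1)] step(3)] show ?case
      by simp
  qed (simp add: even_span.zero)
  fix x y assume "x \<in> even_span b K" "y \<in> even_span b K"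
  then show "x - y \<in> even_span b K"
  proof (induction arbitrary: y)
    case zero
    then show ?case
      by (simp add: minus)
  next
    case (step k p)
    from step.prems show ?case
    proof cases
      case zero
      then show ?thesis
        using even_span.step[OF step.hyps] by simp
    next
      case y: (step l q)
      have "k + b * (b * p) - y = (k - l) + b * (b * (p - q))"
        using y(1) by (simp add: algebra_simps)
      with even_span.step[OF right_idealD(2)[OF K step(1) y(2)] step.IH[OF y(3)]]
      show ?thesis
        by (simp only:)
    qed
  qed
next
  fix x r assume "x \<in> even_span b K"
  then show "x * r \<in> even_span b K"
  proof induction
    case (step k p)
    have "(k + b * (b * p)) * r = k * r + b * (b * (p * r))"
      by (simp add: algebra_simps)
    with even_span.step[OF right_idealD(3)[OF K step(1)] step(3)] show ?case
      by simp
  qed (simp add: even_span.zero)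
qed

text \<open>
  If \<open>b\<close> acts injectively modulo \<open>N\<close> and \<open>K\<close> is independent of the image of \<open>b\<close> modulo \<open>N\<close>, then the
  translates \<open>K\<close>, \<open>b K\<close>, \<open>b\<^sup>2 K\<close>, ... are independent modulo \<open>N\<close>, by peeling off lowest terms. So the
  even and the odd part of their sum are independent modulo \<open>N\<close>.
\<close>
lemma even_span_odd_part_independent:
  assumes K: "right_ideal K"
    and inj: "\<And>x. b * x \<in> N \<Longrightarrow> x \<in> N"
    and indep: "\<And>k x. k \<in> K \<Longrightarrow> k + b * x \<in> N \<Longrightarrow> k = 0"
  assumes "p \<in> even_span b K" "q \<in> even_span b K" "p - b * q \<in> N"
  shows "p = 0"
  using assms(4-6)
proof (induction arbitrary: q)
  case zero
  show ?case ..
next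
  case (step k p)
  obtain l q' where q: "l \<in> K" "q' \<in> even_span b K" "q = l + b * (b * q')"
    using step.prems(1)
  proof cases
    case zero
    then show thesis
      using that[of 0 0] right_idealD(1)[OF K] by (simp add: even_span.zero)
  qed (use that in blast)
  have "k + b * (b * p - q) \<in> N"
    using step.prems(2) by (simp add: algebra_simps)
  then have k: "k = 0"
    by (rule indep[OF step.hyps(1)])
  have "b * (b * p - q) \<in> N"
    using step.prems(2) k by (simp add: algebra_simps)
  then have lowest: "- l + b * (p - b * q') \<in> N"
    using inj q(3) by (simp add: algebra_simps)
  then have "- l = 0"
    by (rule indep[OF right_idealD(4)[OF K q(1)]])
  then have "p - b * q' \<in> N"
    using lowest inj by simp
  then show ?case
    using step.IH[OF q(2)] k by simp
qed

section \<open>Maximal partial decompositions\<close>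

text \<open>
  Let \<open>N\<close> be the closure of \<open>A + B\<close>. Elements outside \<open>N\<close> that \<open>a\<close> maps into \<open>N\<close> can be put into \<open>A\<close>,
  since \<open>a - 1\<close> is \<open>-1\<close> on them modulo \<open>N\<close>; likewise those that \<open>a - 1\<close> maps into \<open>N\<close> can be put
  into \<open>B\<close>. If both maps are injective modulo \<open>N\<close> and \<open>a\<close> has essential image there, a
  complement of \<open>N\<close> can be put into \<open>B\<close>. Otherwise \<open>a\<close> acts as a shift on the independent sum of
  the \<open>a\<^sup>i K\<close>, where \<open>K\<close> avoids the image, and with \<open>P\<close> the even part of this sum the enlargement
  is by \<open>(1 + a + a\<^sup>2) P\<close> and \<open>P\<close>. This works because \<open>(1 + a + a\<^sup>2) P + P = P + a P\<close> and,
  since \<open>(a - 1) (1 + a + a\<^sup>2) = a\<^sup>3 - 1\<close>, also the image \<open>(a\<^sup>3 - 1) P + a P\<close> equals \<open>P + a P\<close>.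
\<close>
lemma partial_decomposition_enlarge:
  fixes a :: "'a::{ring, monoid_mult}"
  assumes ns: "right_nonsingular TYPE('a)" and c1: "C1 TYPE('a)"
    and dec: "partial_decomposition a A B"
    and not_dense: "ess_closure (A + B) \<noteq> UNIV"
  obtains A' B' where "partial_decomposition a A' B'" "A \<subseteq> A'" "B \<subseteq> B'" "(A', B') \<noteq> (A, B)"
proof -
  note A = partial_decompositionD(1)[OF dec] and B = partial_decompositionD(2)[OF dec]
  have W: "right_ideal (A + B)"
    by (rule right_ideal_plus[OF A B])
  define N where "N = ess_closure (A + B)"
  have N: "right_ideal N"
    unfolding N_def by (rule right_ideal_ess_closure[OF W])
  have N_closed: "ess_closure N = N"
    unfolding N_def by (rule ess_closure_idem[OF ns W])
  have WN: "A \<subseteq> N" "B \<subseteq> N"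
    using subset_ess_closure[OF W] subset_plus_right_ideal[OF A B] by (auto simp: N_def)
  have aN: "a * x \<in> N" if "x \<in> N" for x
    using partial_decomposition_invariant[OF ns dec] that by (simp add: N_def)
  have a1N: "(a - 1) * x \<in> N" if "x \<in> N" for x
    using right_idealD(2)[OF N aN[OF that] that] by (simp add: algebra_simps)
  note result = that

  \<comment> \<open>Enlargements by ideals that are independent of \<open>N\<close> are proper.\<close>
  have enlarge: thesis if CD: "right_ideal C" "right_ideal D" "C \<noteq> {0} \<or> D \<noteq> {0}"
    and indep: "\<And>x y. x \<in> C \<Longrightarrow> y \<in> D \<Longrightarrow> x + y \<in> N \<Longrightarrow> x = 0 \<and> y = 0"
    and inj: "\<And>x y. x \<in> C \<Longrightarrow> y \<in> D \<Longrightarrow> (a - 1) * x + a * y \<in> N \<Longrightarrow> x = 0 \<and> y = 0"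
    and into: "\<And>x y. x \<in> C \<Longrightarrow> y \<in> D \<Longrightarrow> (a - 1) * x + a * y \<in> ess_closure (C + D + N)"
    and onto: "\<And>x y. x \<in> C \<Longrightarrow> y \<in> D \<Longrightarrow>
      x + y \<in> ess_closure ((*) (a - 1) ` C + (*) a ` D + N)" for C D
  proof (rule result)
    show "partial_decomposition a (A + C) (B + D)"
      by (rule partial_decomposition_extend[OF ns dec CD(1,2) N_def indep inj into onto])
    show "A \<subseteq> A + C" "B \<subseteq> B + D"
      by (rule subset_plus_right_ideal[OF A CD(1)] subset_plus_right_ideal[OF B CD(2)])+
    show "(A + C, B + D) \<noteq> (A, B)"
    proof
      assume "(A + C, B + D) = (A, B)"
      then have "C \<subseteq> N" "D \<subseteq> N"
        using subset_plus_right_ideal(2)[OF A CD(1)] subset_plus_right_ideal(2)[OF B CD(2)] WN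
        by auto
      then have "C \<subseteq> {0}" "D \<subseteq> {0}"
        using indep right_idealD(1)[OF CD(1)] right_idealD(1)[OF CD(2)]
        by (metis add.right_neutral singletonI subset_iff, metis add.left_neutral singletonI subset_iff)
      then show False
        using CD(3) right_idealD(1)[OF CD(1)] right_idealD(1)[OF CD(2)] by auto
    qed
  qed

  have preimage: "right_ideal {x. b * x \<in> N}" for b
    using right_idealD[OF N]
    by (auto simp: right_ideal_def right_diff_distrib mult.assoc[symmetric])
  consider (ker) "\<not> {x. a * x \<in> N} \<subseteq> N" | (ker1) "\<not> {x. (a - 1) * x \<in> N} \<subseteq> N"
    | (dense) "{x. a * x \<in> N} \<subseteq> N" "{x. (a - 1) * x \<in> N} \<subseteq> N"
        "ess_closure (range ((*) a) + N) = UNIV"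
    | (shift) "{x. a * x \<in> N} \<subseteq> N" "{x. (a - 1) * x \<in> N} \<subseteq> N"
        "ess_closure (range ((*) a) + N) \<noteq> UNIV"
    by blast
  then show thesis
  proof cases
    case ker
    obtain C where C: "right_ideal C" "C \<subseteq> {x. a * x \<in> N}" "C \<noteq> {0}" "C \<inter> N = {0}"
      using independent_right_ideal_outside_closed[OF N_closed N preimage ker] .
    show thesis
    proof (rule enlarge[OF C(1) right_ideal_zero])
      show "C \<noteq> {0} \<or> {0 :: 'a} \<noteq> {0}"
        using C(3) by simp
    next
      fix x y assume xy: "x \<in> C" "y \<in> {0::'a}"
      have ax: "a * x \<in> N"
        using C(2) xy(1) by auto
      show "x = 0 \<and> y = 0" if "x + y \<in> N"
        using that xy C(4) by auto
      show "x = 0 \<and> y = 0" if "(a - 1) * x + a * y \<in> N"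
      proof -
        have "x \<in> N"
          using right_idealD(2)[OF N ax that] xy(2) by (simp add: algebra_simps)
        then show ?thesis
          using xy C(4) by auto
      qed
      have "- x + 0 + a * x \<in> C + {0} + N"
        using right_idealD(4)[OF C(1) xy(1)] ax by (intro set_plus_intro) auto
      then show "(a - 1) * x + a * y \<in> ess_closure (C + {0} + N)"
        using xy(2) subset_ess_closure[OF right_ideal_plus[OF right_ideal_plus[OF C(1) right_ideal_zero] N]]
        by (auto simp: algebra_simps)
      have "(a - 1) * (- x) + a * 0 + a * x \<in> (*) (a - 1) ` C + (*) a ` {0} + N"
        using right_idealD(4)[OF C(1) xy(1)] ax by (intro set_plus_intro imageI) auto
      then show "x + y \<in> ess_closure ((*) (a - 1) ` C + (*) a ` {0} + N)"
        using xy(2) subset_ess_closure[OF right_ideal_plus[OF right_ideal_plus[OF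
              right_ideal_left_mult[OF C(1)] right_ideal_left_mult[OF right_ideal_zero]] N], of "a - 1" a]
        by (auto simp: algebra_simps)
    qed
  next
    case ker1
    obtain C where C: "right_ideal C" "C \<subseteq> {x. (a - 1) * x \<in> N}" "C \<noteq> {0}" "C \<inter> N = {0}"
      using independent_right_ideal_outside_closed[OF N_closed N preimage ker1] .
    show thesis
    proof (rule enlarge[OF right_ideal_zero C(1)])
      show "{0 :: 'a} \<noteq> {0} \<or> C \<noteq> {0}"
        using C(3) by simp
    next
      fix x y assume xy: "x \<in> {0::'a}" "y \<in> C"
      have ay: "(a - 1) * y \<in> N"
        using C(2) xy(2) by auto
      show "x = 0 \<and> y = 0" if "x + y \<in> N"
        using that xy C(4) by auto
      show "x = 0 \<and> y = 0" if "(a - 1) * x + a * y \<in> N"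
      proof -
        have "y \<in> N"
          using right_idealD(2)[OF N that ay] xy(1) by (simp add: algebra_simps)
        then show ?thesis
          using xy C(4) by auto
      qed
      have "0 + y + (a - 1) * y \<in> {0} + C + N"
        using xy(2) ay by (intro set_plus_intro) auto
      then show "(a - 1) * x + a * y \<in> ess_closure ({0} + C + N)"
        using xy(1) subset_ess_closure[OF right_ideal_plus[OF right_ideal_plus[OF right_ideal_zero C(1)] N]]
        by (auto simp: algebra_simps)
      have "(a - 1) * 0 + a * y + - ((a - 1) * y) \<in> (*) (a - 1) ` {0} + (*) a ` C + N"
        using xy(2) right_idealD(4)[OF N ay] by (intro set_plus_intro) auto
      then show "x + y \<in> ess_closure ((*) (a - 1) ` {0} + (*) a ` C + N)"
        using xy(1) subset_ess_closure[OF right_ideal_plus[OF right_ideal_plus[OF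
              right_ideal_left_mult[OF right_ideal_zero] right_ideal_left_mult[OF C(1)]] N], of "a - 1" a]
        by (auto simp: algebra_simps)
    qed
  next
    case dense
    obtain D where D: "direct_summand D" "essential_in (A + B) D"
      using C1D[OF c1 W] .
    obtain C where C: "right_ideal C" "D \<inter> C = {0}" "D + C = UNIV"
      using D(1) unfolding direct_summand_def by blast
    \<comment> \<open>The summand \<open>D\<close> is \<open>N\<close> itself: \<open>D\<close> lies in \<open>N\<close>, and its complement \<open>C\<close> meets \<open>N\<close> trivially.\<close>
    have DN: "D \<subseteq> N"
      unfolding N_def by (rule essential_in_imp_subset_ess_closure[OF D(2)])
    have CN: "c = 0" if c: "c \<in> C" "c \<in> N" for c
    proof (rule ccontr)
      assume "c \<noteq> 0"
      then obtain r where "c * r \<in> A + B" "c * r \<noteq> 0"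
        using ess_closure_meets[OF ns c(2)[unfolded N_def]] by blast
      moreover have "A + B \<subseteq> D"
        using D(2) by (auto simp: essential_in_def)
      ultimately show False
        using C(2) right_idealD(3)[OF C(1) c(1), of r] by blast
    qed
    have total: "{0} + C + N = UNIV"
      using C(3) set_plus_mono2[OF DN order_refl[of C]] by (auto simp: add.commute)
    have onto: "right_ideal ((*) (a - 1) ` {0} + (*) a ` C + N)"
      by (intro right_ideal_plus right_ideal_left_mult right_ideal_zero C N)
    show thesis
    proof (rule enlarge[OF right_ideal_zero C(1)])
      show "{0 :: 'a} \<noteq> {0} \<or> C \<noteq> {0}"
      proof (rule ccontr)
        assume "\<not> ({0::'a} \<noteq> {0} \<or> C \<noteq> {0})"
        then have "N = UNIV"
          using total by simp
        then show False
          using not_dense by (simp add: N_def)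
      qed
    next
      fix x y assume xy: "x \<in> {0::'a}" "y \<in> C"
      show "x = 0 \<and> y = 0" if "x + y \<in> N"
        using that xy CN by auto
      show "x = 0 \<and> y = 0" if "(a - 1) * x + a * y \<in> N"
        using that xy CN dense(1) by auto
      show "(a - 1) * x + a * y \<in> ess_closure ({0} + C + N)"
        unfolding total using subset_ess_closure[OF right_ideal_UNIV] by auto
      have "a * z \<in> (*) (a - 1) ` {0} + (*) a ` C + N" for z
      proof -
        obtain c n where cn: "c \<in> C" "n \<in> N" "z = c + n"
          using total by (metis UNIV_I add_0 set_plus_elim singletonD set_zero)
        then have "(a - 1) * 0 + a * c + a * n \<in> (*) (a - 1) ` {0} + (*) a ` C + N"
          by (intro set_plus_intro aN) auto
        then show ?thesis
          using cn by (simp add: distrib_left)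
      qed
      then have "range ((*) a) + N \<subseteq> (*) (a - 1) ` {0} + (*) a ` C + N"
        using subset_plus_right_ideal(2)[OF right_ideal_plus[OF right_ideal_left_mult[OF right_ideal_zero]
              right_ideal_left_mult[OF C(1)]] N]
        by - (rule plus_subset_right_ideal[OF onto]; auto)
      then show "x + y \<in> ess_closure ((*) (a - 1) ` {0} + (*) a ` C + N)"
        using ess_closure_mono dense(3) by blast
    qed
  next
    case shift
    let ?I = "range ((*) a) + N"
    have I: "right_ideal ?I"
      by (intro right_ideal_plus right_ideal_left_mult right_ideal_UNIV N)
    note cI = right_ideal_ess_closure[OF I]
    obtain K where K: "right_ideal K" "K \<noteq> {0}" "K \<inter> ess_closure ?I = {0}"
      using independent_right_ideal_outside_closed[OF ess_closure_idem[OF ns I] cI right_ideal_UNIV]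
        shift(3) by blast
    have K_indep: "k = 0" if "k \<in> K" "k + a * x \<in> N" for k x
    proof -
      have "a * (- x) + (k + a * x) \<in> ?I"
        using that(2) by (intro set_plus_intro rangeI)
      then have "k \<in> ?I"
        by (simp add: algebra_simps)
      then show ?thesis
        using K(3) that(1) subset_ess_closure[OF I] by auto
    qed
    have inj: "x \<in> N" if "a * x \<in> N" for x
      using that shift(1) by auto
    define P where "P = even_span a K"
    have P: "right_ideal P"
      unfolding P_def by (rule right_ideal_even_span[OF K(1)])
    have a2P: "a * (a * p) \<in> P" if "p \<in> P" for p
      using even_span_double_step[OF K(1)] that by (simp add: P_def)
    note PI = right_idealD(1,4,5)[OF P]
    have P_odd: "p = 0" if "p \<in> P" "q \<in> P" "p - a * q \<in> N" for p q
      using even_span_odd_part_independent[OF K(1) inj K_indep] that by (simp add: P_def)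
    have P_N: "p = 0" if "p \<in> P" "p \<in> N" for p
      using P_odd[OF that(1) right_idealD(1)[OF P]] that(2) by simp
    have "P \<noteq> {0}"
      using K(2) right_idealD(1)[OF K(1)] subset_even_span[of K a] by (auto simp: P_def)
    define Q where "Q = (*) (1 + a + a * a) ` P"
    have Q: "right_ideal Q"
      unfolding Q_def by (rule right_ideal_left_mult[OF P])
    let ?V = "(*) (a - 1) ` Q + (*) a ` P"
    have V: "right_ideal ?V"
      by (intro right_ideal_plus right_ideal_left_mult Q P)
    have "?V \<subseteq> ?V + N" "Q + P \<subseteq> Q + P + N"
      by (rule subset_plus_right_ideal(1)[OF V N]
          subset_plus_right_ideal(1)[OF right_ideal_plus[OF Q P] N])+
    then have closures: "?V \<subseteq> ess_closure (?V + N)" "Q + P \<subseteq> ess_closure (Q + P + N)"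
      using subset_ess_closure[OF right_ideal_plus[OF V N]]
        subset_ess_closure[OF right_ideal_plus[OF right_ideal_plus[OF Q P] N]] by auto
    have P_QP: "p \<in> Q + P" and aP_QP: "a * p \<in> Q + P" if "p \<in> P" for p
    proof -
      show "p \<in> Q + P"
        using subset_plus_right_ideal(2)[OF Q P] that by auto
      have "(1 + a + a * a) * p + - (p + a * (a * p)) \<in> Q + P"
        unfolding Q_def by (intro set_plus_intro imageI PI a2P that)
      then show "a * p \<in> Q + P"
        by (simp add: algebra_simps)
    qed
    have aP_V: "a * p \<in> ?V" and P_V: "p \<in> ?V" if "p \<in> P" for p
    proof -
      have "(a - 1) * ((1 + a + a * a) * 0) + a * p \<in> ?V"
        unfolding Q_def by (intro set_plus_intro imageI PI that)
      then show "a * p \<in> ?V"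
        by simp
      have "(a - 1) * ((1 + a + a * a) * (- p)) + a * (a * (a * p)) \<in> ?V"
        unfolding Q_def by (intro set_plus_intro imageI PI a2P that)
      then show "p \<in> ?V"
        by (simp add: algebra_simps)
    qed
    show thesis
    proof (rule enlarge[OF Q P])
      show "Q \<noteq> {0} \<or> P \<noteq> {0}"
        using \<open>P \<noteq> {0}\<close> by simp
    next
      fix x y assume x: "x \<in> Q" and y: "y \<in> P"
      obtain p where p: "p \<in> P" "x = (1 + a + a * a) * p"
        using x by (auto simp: Q_def)
      show "x = 0 \<and> y = 0" if "x + y \<in> N"
      proof -
        have "(p + a * (a * p) + y) - a * (- p) \<in> N"
          using that p(2) by (simp add: algebra_simps)
        then have "p + a * (a * p) + y = 0"
          by (rule P_odd[rotated 2]) (intro PI p a2P y)+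
        then have "a * p \<in> N"
          using \<open>(p + a * (a * p) + y) - a * (- p) \<in> N\<close> by simp
        then have "p = 0"
          using inj P_N p(1) by blast
        then show ?thesis
          using \<open>p + a * (a * p) + y = 0\<close> p(2) by simp
      qed
      have image: "(a - 1) * x + a * y = a * (a * (a * p) + y) - p"
        using p(2) by (simp add: algebra_simps)
      show "x = 0 \<and> y = 0" if "(a - 1) * x + a * y \<in> N"
      proof -
        have "p - a * (a * (a * p) + y) \<in> N"
          using right_idealD(4)[OF N that] image by simp
        then have "p = 0"
          by (rule P_odd[rotated 2]) (intro PI p a2P y)+
        then have "a * y \<in> N"
          using that image by simp
        then have "y = 0"
          using inj P_N[OF y] by blast
        then show ?thesis
          using \<open>p = 0\<close> p(2) by simp
      qed
      have "(a - 1) * x + a * y \<in> Q + P"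
        unfolding image
        by (rule right_idealD(2)[OF right_ideal_plus[OF Q P] aP_QP P_QP]) (intro PI a2P p y)+
      then show "(a - 1) * x + a * y \<in> ess_closure (Q + P + N)"
        using closures by auto
      have "p + a * p + a * (a * p) + y \<in> ?V"
        by (intro right_idealD(5)[OF V] aP_V[OF p(1)] P_V a2P p y)
      then have "x + y \<in> ?V"
        using p(2) by (simp add: algebra_simps)
      then show "x + y \<in> ess_closure (?V + N)"
        using closures by auto
    qed
  qed
qed

lemma right_ideal_chain_Union:
  assumes "S \<noteq> {}" "\<And>I. I \<in> S \<Longrightarrow> right_ideal I"
    and "\<And>I J. I \<in> S \<Longrightarrow> J \<in> S \<Longrightarrow> I \<subseteq> J \<or> J \<subseteq> I"
  shows "right_ideal (\<Union>S)"
  unfolding right_ideal_def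
proof (intro conjI ballI allI)
  show "0 \<in> \<Union>S"
    using assms(1) right_idealD(1)[OF assms(2)] by blast
next
  fix x y assume "x \<in> \<Union>S" "y \<in> \<Union>S"
  then obtain I J where IJ: "I \<in> S" "x \<in> I" "J \<in> S" "y \<in> J"
    by blast
  then obtain M where "M \<in> S" "x \<in> M" "y \<in> M"
    using assms(3)[OF IJ(1,3)] by blast
  then show "x - y \<in> \<Union>S"
    using right_idealD(2)[OF assms(2)] by blast
next
  fix x r assume "x \<in> \<Union>S"
  then show "x * r \<in> \<Union>S"
    using right_idealD(3)[OF assms(2)] by blast
qed

lemma partial_decomposition_chain_Union:
  fixes a :: "'a::{ring, monoid_mult}"
  assumes "\<C> \<noteq> {}"
    and dec: "\<And>A B. (A, B) \<in> \<C> \<Longrightarrow> partial_decomposition a A B"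
    and chain: "\<And>p q. p \<in> \<C> \<Longrightarrow> q \<in> \<C> \<Longrightarrow>
      fst p \<subseteq> fst q \<and> snd p \<subseteq> snd q \<or> fst q \<subseteq> fst p \<and> snd q \<subseteq> snd p"
  shows "partial_decomposition a (\<Union>(fst ` \<C>)) (\<Union>(snd ` \<C>))"
proof -
  let ?A = "\<Union>(fst ` \<C>)" and ?B = "\<Union>(snd ` \<C>)"
  have ideals: "right_ideal (fst p)" "right_ideal (snd p)" if "p \<in> \<C>" for p
    using partial_decompositionD(1,2)[OF dec, of "fst p" "snd p"] that by simp_all
  have "right_ideal ?A"
    by (rule right_ideal_chain_Union) (use assms(1) ideals chain in blast)+
  moreover have "right_ideal ?B"
    by (rule right_ideal_chain_Union) (use assms(1) ideals chain in blast)+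
  moreover have "(x + y = 0 \<longrightarrow> x = 0 \<and> y = 0) \<and>
      ((a - 1) * x + a * y = 0 \<longrightarrow> x = 0 \<and> y = 0) \<and>
      (a - 1) * x + a * y \<in> ess_closure (?A + ?B) \<and>
      x + y \<in> ess_closure ((*) (a - 1) ` ?A + (*) a ` ?B)"
    if xy: "x \<in> ?A" "y \<in> ?B" for x y
  proof -
    obtain p q where pq: "p \<in> \<C>" "x \<in> fst p" "q \<in> \<C>" "y \<in> snd q"
      using xy by auto
    then obtain s where "s \<in> \<C>" "x \<in> fst s" "y \<in> snd s"
      using chain[OF pq(1,3)] by blast
    then obtain A B where AB: "(A, B) \<in> \<C>" "x \<in> A" "y \<in> B"
      by (cases s) simp
    have sub: "A \<subseteq> ?A" "B \<subseteq> ?B"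
      using AB(1) by force+
    have "ess_closure (A + B) \<subseteq> ess_closure (?A + ?B)"
      "ess_closure ((*) (a - 1) ` A + (*) a ` B) \<subseteq> ess_closure ((*) (a - 1) ` ?A + (*) a ` ?B)"
      by (intro ess_closure_mono set_plus_mono2 image_mono sub)+
    then show ?thesis
      using partial_decompositionD(3-6)[OF dec[OF AB(1)] AB(2,3)] by blast
  qed
  ultimately show ?thesis
    unfolding partial_decomposition_def by blast
qed

lemma exists_dense_partial_decomposition:
  fixes a :: "'a::{ring, monoid_mult}"
  assumes ns: "right_nonsingular TYPE('a)" and c1: "C1 TYPE('a)"
  obtains A B where "partial_decomposition a A B" "ess_closure (A + B) = UNIV"
proof -
  let ?D = "{(A, B). partial_decomposition a A B}"
  let ?le = "\<lambda>p q :: 'a set \<times> 'a set. fst p \<subseteq> fst q \<and> snd p \<subseteq> snd q"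
  have "\<exists>m\<in>?D. \<forall>p\<in>?D. ?le m p \<longrightarrow> p = m"
  proof (rule predicate_Zorn[where P = ?le])
    show "partial_order_on ?D (relation_of ?le ?D)"
      by (rule partial_order_on_relation_ofI) auto
  next
    fix \<C> assume "\<C> \<in> Chains (relation_of ?le ?D)"
    then have sub: "\<C> \<subseteq> ?D" and chain: "\<And>p q. p \<in> \<C> \<Longrightarrow> q \<in> \<C> \<Longrightarrow> ?le p q \<or> ?le q p"
      by (auto simp: Chains_def relation_of_def)
    show "\<exists>u\<in>?D. \<forall>p\<in>\<C>. ?le p u"
    proof (cases "\<C> = {}")
      case True
      then show ?thesis
        using partial_decomposition_zero[of a] by auto
    next
      case False
      have "partial_decomposition a (\<Union>(fst ` \<C>)) (\<Union>(snd ` \<C>))"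
        using False sub chain by (intro partial_decomposition_chain_Union) auto
      then show ?thesis
        by (intro bexI[of _ "(\<Union>(fst ` \<C>), \<Union>(snd ` \<C>))"]) auto
    qed
  qed
  then obtain A B where dec: "partial_decomposition a A B"
    and max: "\<And>A' B'. partial_decomposition a A' B' \<Longrightarrow> A \<subseteq> A' \<Longrightarrow> B \<subseteq> B' \<Longrightarrow> (A', B') = (A, B)"
    by fastforce
  have "ess_closure (A + B) = UNIV"
    using partial_decomposition_enlarge[OF ns c1 dec] max by metis
  with dec that show thesis
    by blast
qed

section \<open>Idempotents from complementary right ideals\<close>

text \<open>
  By (C1) both ideals are essential in summands; these are still independent, so by (C3) their sum
  is a summand. It is essential as well, hence everything, and \<open>e\<close> is the component of \<open>1\<close>.
\<close>
lemma quasi_continuous_idempotent: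
  fixes A B :: "'a::{ring, monoid_mult} set"
  assumes ns: "right_nonsingular TYPE('a)" and qc: "right_quasi_continuous TYPE('a)"
    and A: "right_ideal A" and B: "right_ideal B"
    and disjoint: "A \<inter> B = {0}" and dense: "ess_closure (A + B) = UNIV"
  obtains e where "e * e = e" "\<And>x. x \<in> A \<Longrightarrow> e * x = x" "\<And>y. y \<in> B \<Longrightarrow> e * y = 0"
proof -
  have c1: "C1 TYPE('a)" and c3: "C3 TYPE('a)"
    using qc by (simp_all add: right_quasi_continuous_def)
  obtain D where D: "direct_summand D" "essential_in A D"
    using C1D[OF c1 A] .
  obtain F where F: "direct_summand F" "essential_in B F"
    using C1D[OF c1 B] .
  have DI: "right_ideal D" and FI: "right_ideal F" and sub: "A \<subseteq> D" "B \<subseteq> F"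
    using D(2) F(2) by (auto simp: essential_in_def)
  have DF0: "x = 0" if x: "x \<in> D" "x \<in> F" for x
  proof (rule ccontr)
    assume "x \<noteq> 0"
    then obtain r where r: "x * r \<in> A" "x * r \<noteq> 0"
      using essential_in_element[OF D(2) x(1)] by blast
    obtain s where s: "x * r * s \<in> B" "x * r * s \<noteq> 0"
      using essential_in_element[OF F(2) right_idealD(3)[OF FI x(2)] r(2)] .
    then show False
      using disjoint right_idealD(3)[OF A r(1), of s] by blast
  qed
  have "D \<inter> F = {0}"
    using right_idealD(1)[OF DI] right_idealD(1)[OF FI] DF0 by blast
  then have "direct_summand (D + F)"
    using c3 D(1) F(1) unfolding C3_def by blast
  then obtain G where G: "right_ideal G" "(D + F) \<inter> G = {0}" "(D + F) + G = UNIV"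
    unfolding direct_summand_def by blast
  have "g = 0" if g: "g \<in> G" for g
  proof (rule ccontr)
    assume "g \<noteq> 0"
    then obtain r where "g * r \<in> A + B" "g * r \<noteq> 0"
      using ess_closure_meets[OF ns, of g "A + B"] dense by blast
    then show False
      using G(2) right_idealD(3)[OF G(1) g, of r] set_plus_mono2[OF sub] by blast
  qed
  then have "G = {0}"
    using right_idealD(1)[OF G(1)] by auto
  then have "1 \<in> D + F"
    using G(3) by simp
  then obtain e f where ef: "e \<in> D" "f \<in> F" "1 = e + f"
    by (rule set_plus_elim)
  have e_D: "e * x = x" if "x \<in> D" for x
  proof -
    have fx: "f * x = x - e * x"
      using arg_cong[OF ef(3), of "\<lambda>t. t * x"] by (simp add: distrib_right eq_diff_eq add.commute)
    have "f * x \<in> D"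
      unfolding fx using that ef(1) by (intro right_idealD[OF DI])
    then have "f * x = 0"
      using DF0 right_idealD(3)[OF FI ef(2)] by blast
    then show ?thesis
      using fx by simp
  qed
  have e_F: "e * y = 0" if "y \<in> F" for y
  proof -
    have ey: "e * y = y - f * y"
      using arg_cong[OF ef(3), of "\<lambda>t. t * y"] by (simp add: distrib_right eq_diff_eq)
    have "e * y \<in> F"
      unfolding ey using that ef(2) by (intro right_idealD[OF FI])
    then show ?thesis
      using DF0 right_idealD(3)[OF DI ef(1)] by blast
  qed
  show thesis
    using that[of e] e_D e_F ef(1) sub by blast
qed

text \<open>A right annihilator that vanishes on an essential right ideal is zero; a left annihilator
  of an essential right ideal is zero by nonsingularity.\<close>
lemma regular_elementI:
  fixes u :: "'a::{ring, monoid_mult}"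
  assumes ns: "right_nonsingular TYPE('a)"
    and dense: "ess_closure W = UNIV" and inj: "\<And>w. w \<in> W \<Longrightarrow> u * w = 0 \<Longrightarrow> w = 0"
    and image_dense: "ess_closure ((*) u ` W) = UNIV"
  shows "regular_element u"
proof -
  have "r = 0" if "u * r = 0" for r
  proof (rule ccontr)
    assume "r \<noteq> 0"
    then obtain s where s: "r * s \<in> W" "r * s \<noteq> 0"
      using ess_closure_meets[OF ns, of r W] dense by blast
    have "u * (r * s) = 0"
      using that by (simp add: mult.assoc[symmetric])
    then show False
      using inj s by blast
  qed
  moreover have "r = 0" if "r * u = 0" for r
  proof -
    have "r * n \<in> {0}" if "n \<in> (*) u ` W" for n
      using that \<open>r * u = 0\<close> by (auto simp: mult.assoc[symmetric])
    from left_mult_ess_closure[of "(*) u ` W", OF this, of 1] have "r * 1 \<in> ess_closure {0}"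
      unfolding image_dense by simp
    then show ?thesis
      using nonsingular_ess_closure_zero[OF ns, of r] by simp
  qed
  ultimately show ?thesis
    using mult_zero_left[of u] mult_zero_right[of u]
    unfolding regular_element_def left_annihilator_def right_annihilator_def by blast
qed

theorem proposition2p3:
  assumes "right_quasi_continuous TYPE('a::{ring, monoid_mult})"
    and "right_nonsingular TYPE('a)"
  shows "almost_clean TYPE('a)"
  unfolding almost_clean_def
proof
  note qc = assms(1) and ns = assms(2)
  fix a :: 'a
  have "C1 TYPE('a)"
    using qc by (simp add: right_quasi_continuous_def)
  then obtain A B where dec: "partial_decomposition a A B" and dense: "ess_closure (A + B) = UNIV"
    using exists_dense_partial_decomposition[OF ns] by blast
  note A = partial_decompositionD(1)[OF dec] and B = partial_decompositionD(2)[OF dec]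
  have "x = 0" if "x \<in> A" "x \<in> B" for x
    using partial_decompositionD(3)[OF dec that(1) right_idealD(4)[OF B that(2)]] by simp
  then have "A \<inter> B = {0}"
    using right_idealD(1)[OF A] right_idealD(1)[OF B] by auto
  then obtain e where e: "e * e = e" "\<And>x. x \<in> A \<Longrightarrow> e * x = x" "\<And>y. y \<in> B \<Longrightarrow> e * y = 0"
    using quasi_continuous_idempotent[OF ns qc A B _ dense] by blast
  let ?u = "a - e"
  have u: "?u * (x + y) = (a - 1) * x + a * y" if "x \<in> A" "y \<in> B" for x y
    using e(2)[OF that(1)] e(3)[OF that(2)] by (simp add: algebra_simps)
  have W: "right_ideal (A + B)"
    by (rule right_ideal_plus[OF A B])
  have "regular_element ?u"
  proof (rule regular_elementI[OF ns dense])
    show "w = 0" if w: "w \<in> A + B" "?u * w = 0" for w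
    proof -
      obtain x y where xy: "x \<in> A" "y \<in> B" "w = x + y"
        using w(1) by (rule set_plus_elim)
      then show ?thesis
        using partial_decompositionD(4)[OF dec xy(1,2)] u[OF xy(1,2)] w(2) by simp
    qed
    have "(*) (a - 1) ` A + (*) a ` B \<subseteq> (*) ?u ` (A + B)"
      using u by (force elim!: set_plus_elim intro!: image_eqI set_plus_intro)
    then have "ess_closure ((*) (a - 1) ` A + (*) a ` B) \<subseteq> ess_closure ((*) ?u ` (A + B))"
      by (rule ess_closure_mono)
    then have "A + B \<subseteq> ess_closure ((*) ?u ` (A + B))"
      using partial_decompositionD(6)[OF dec] by (auto elim!: set_plus_elim)
    then show "ess_closure ((*) ?u ` (A + B)) = UNIV"
      using ess_closure_least[OF ns right_ideal_left_mult[OF W]] dense by blast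
  qed
  then show "\<exists>u e. regular_element u \<and> idempotent_element e \<and> a = u + e"
    using e(1) by (intro exI[of _ ?u] exI[of _ e]) (simp add: idempotent_element_def)
qed

end
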